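(* Let $\lambda>1$. For interval selection with proportional weights and revocable acceptances, Algorithm Revoke-Proportional with parameter $\lambda$ is $\frac{4\lambda^2+2\lambda}{\lambda-1}$-robust; that is, for every instance, every arrival order and every (arbitrary) assignment of predictions, $\frac{OPT}{ALG}\le \frac{4\lambda^2+2\lambda}{\lambda-1}$.
   Context: Interval selection: an instance is a finite nonempty set of intervals $[s_i,f_i)$ on the real line, $s_i<f_i$, arriving one at a time in an arbitrary (adversarial) order. Two intervals conflict if they intersect. Proportional weights means $w([s,f))=f-s$. The goal is to output a set of pairwise disjoint intervals of maximum total weight. $OPT$ denotes the maximum total weight of a set of pairwise disjoint intervals of the instance, and $ALG$ the total weight of the algorithm's final solution. Revocable acceptances: a newly arrived interval may be accepted by discarding all conflicting intervals in the current solution; rejected or discarded intervals can never be used again. Predictions: each interval $I$ arrives together with a bit $Prd(I)\in\{0,1\}$ (predicting whether $I$ belongs to a fixed optimal solution), which may be wrong. An algorithm is (strictly) $c$-competitive if $OPT/ALG\le c$ for all instances and arrival orders; it is $\zeta$-robust if it is $\zeta$-competitive regardless of the accuracy of the predictions. Algorithm Revoke-Proportional (parameter $\lambda>1$): start with an empty solution. On the arrival of $I$, let $I_s$ be the set of intervals currently in the solution conflicting with $I$, and $w_c=\sum_{J\in I_s}w(J)$. (1) Main rule: if $w(I)\ge\lambda\cdot w_c$, accept $I$ and discard all intervals of $I_s$. (2) Predictions rule: otherwise, if $Prd(I)=1$, $w(I)\ge w_c$, and no $J\in I_s$ has $Prd(J)=1$, accept $I$ and discard all intervals of $I_s$. (3)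 Otherwise reject $I$. *)

theory Defs
  imports Complex_Main "HOL-Library.Disjoint_Sets"
begin

text \<open>The pair \<open>(s, f)\<close> stands for the half-open interval $[s,f)$. Well-formedness \<open>s < f\<close> is
  required by \<open>is_instance\<close>; on such pairs \<open>points\<close> is injective.\<close>

type_synonym ivl = "real \<times> real"

definition points :: "ivl \<Rightarrow> real set" where
  "points I = {fst I..<snd I}"

definition conflict :: "ivl \<Rightarrow> ivl \<Rightarrow> bool" where
  "conflict I J \<longleftrightarrow> points I \<inter> points J \<noteq> {}"

definition weight :: "ivl \<Rightarrow> real" where
  "weight I = snd I - fst I"

definition total_weight :: "ivl set \<Rightarrow> real" where
  "total_weight S = (\<Sum>I\<in>S. weight I)"

definition is_instance :: "ivl set \<Rightarrow> bool" where
  "is_instance X \<longleftrightarrow> finite X \<and> X \<noteq> {} \<and> (\<forall>I\<in>X. fst I < snd I)"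

definition arrival_order :: "ivl set \<Rightarrow> ivl list \<Rightarrow> bool" where
  "arrival_order X xs \<longleftrightarrow> distinct xs \<and> set xs = X"

definition feasible :: "ivl set \<Rightarrow> ivl set \<Rightarrow> bool" where
  "feasible X S \<longleftrightarrow> S \<subseteq> X \<and> disjoint_family_on points S"

definition OPT :: "ivl set \<Rightarrow> real" where
  "OPT X = Max {total_weight S | S. feasible X S}"

text \<open>An algorithm is given by the map from the arrival sequence to its final solution. The
  conjunct \<open>ALG > 0\<close> excludes the convention \<open>x / 0 = 0\<close>, under which an algorithm of zero
  profit would have ratio 0 (\<open>OPT > 0\<close> holds for every instance).\<close>

definition competitive :: "real \<Rightarrow> (ivl list \<Rightarrow> ivl set) \<Rightarrow> bool" where
  "competitive c A \<longleftrightarrow>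
     (\<forall>X xs. is_instance X \<and> arrival_order X xs \<longrightarrow>
        (let ALG = total_weight (A xs) in ALG > 0 \<and> OPT X / ALG \<le> c))"

text \<open>With predictions, an algorithm takes the assignment \<open>Prd\<close> of bits to intervals as an
  additional argument; \<open>True\<close> encodes the bit 1.\<close>

definition robust :: "real \<Rightarrow> ((ivl \<Rightarrow> bool) \<Rightarrow> ivl list \<Rightarrow> ivl set) \<Rightarrow> bool" where
  "robust c A \<longleftrightarrow> (\<forall>Prd. competitive c (A Prd))"

definition revoke_proportional_step ::
  "real \<Rightarrow> (ivl \<Rightarrow> bool) \<Rightarrow> ivl \<Rightarrow> ivl set \<Rightarrow> ivl set" where
  "revoke_proportional_step lam Prd I Sol =
     (let Is = {J \<in> Sol. conflict I J};
          wc = total_weight Is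
      in if weight I \<ge> lam * wc then insert I (Sol - Is)
         else if Prd I \<and> weight I \<ge> wc \<and> \<not> (\<exists>J\<in>Is. Prd J) then insert I (Sol - Is)
         else Sol)"

definition revoke_proportional ::
  "real \<Rightarrow> (ivl \<Rightarrow> bool) \<Rightarrow> ivl list \<Rightarrow> ivl set" where
  "revoke_proportional lam Prd xs = fold (revoke_proportional_step lam Prd) xs {}"

end

theory Submission
  imports Defs
begin

text \<open>Let \<open>H\<close> be the set of all intervals ever accepted, discarded ones included.

  An interval accepted by the predictions rule is predicted and replaces unpredicted intervals
  only, so two such replacements cannot follow each other directly. Giving the current solution
  the credit $\frac{\lambda+1}{\lambda-1}$ per unit of unpredicted weight and
  $\frac{2\lambda}{\lambda-1}$ per unit of predicted weight, every acceptance of \<open>I\<close> raises the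
  credit by at least \<open>w(I)\<close>. Hence $w(H) \le \frac{2\lambda}{\lambda-1} ALG$.

  An interval of the instance is either contained in a member of \<open>H\<close> or was rejected, in which
  case its weight is less than $\lambda$ times the weight of the members of \<open>H\<close> in conflict
  with it. Among pairwise disjoint intervals, those contained in \<open>J \<in> H\<close> weigh at most \<open>w(J)\<close>,
  and at most two others conflict with \<open>J\<close>, since they cover one of its end points. Hence
  $OPT \le (2\lambda+1) w(H)$.\<close>

text \<open>The fibres may overlap: every \<open>x\<close> is counted in at least one of them, and
  nonnegativity makes repeated counting harmless.\<close>

lemma sum_le_sum_fibres:
  fixes f :: "'a \<Rightarrow> real"
  assumes "finite A" "finite B" "\<And>x. x \<in> A \<Longrightarrow> 0 \<le> f x" "\<And>x. x \<in> A \<Longrightarrow> \<exists>y\<in>B. R x y"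
  shows "sum f A \<le> (\<Sum>y\<in>B. sum f {x\<in>A. R x y})"
proof -
  have "sum f A \<le> (\<Sum>x\<in>A. \<Sum>y\<in>B. if R x y then f x else 0)"
  proof (rule sum_mono)
    fix x assume x: "x \<in> A"
    then obtain y where y: "y \<in> B" "R x y" using assms(4) by blast
    have "(if R x y then f x else 0) \<le> (\<Sum>y\<in>B. if R x y then f x else 0)"
      using x y assms(2,3) by (intro member_le_sum) auto
    then show "f x \<le> (\<Sum>y\<in>B. if R x y then f x else 0)" using y by simp
  qed
  also have "\<dots> = (\<Sum>y\<in>B. \<Sum>x\<in>A. if R x y then f x else 0)"
    by (rule sum.swap)
  also have "\<dots> = (\<Sum>y\<in>B. sum f {x\<in>A. R x y})"
    using assms(1) by (simp add: sum.inter_filter)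
  finally show ?thesis .
qed

lemma total_weight_insert_le:
  assumes "finite S" "0 \<le> weight I"
  shows "total_weight (insert I S) \<le> weight I + total_weight S"
  using assms by (simp add: total_weight_def sum.insert_if)

lemma total_weight_mono:
  assumes "finite T" "S \<subseteq> T" "\<And>I. I \<in> T \<Longrightarrow> 0 \<le> weight I"
  shows "total_weight S \<le> total_weight T"
  unfolding total_weight_def using assms by (intro sum_mono2) auto

lemma points_subset_iff: "fst I < snd I \<Longrightarrow>
  points I \<subseteq> points J \<longleftrightarrow> fst J \<le> fst I \<and> snd I \<le> snd J"
  by (auto simp: points_def)

text \<open>Intervals are added by increasing left end point. The last one, \<open>I\<close>, starts
  no earlier than the others, so by disjointness they all end by \<open>fst I\<close> and fit
  between \<open>a\<close> and \<open>fst I\<close>; hence the induction varies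
  \<open>b\<close>.\<close>

lemma total_weight_disjoint_le:
  assumes "finite S" "disjoint_family_on points S"
    and "\<And>I. I \<in> S \<Longrightarrow> fst I < snd I \<and> a \<le> fst I \<and> snd I \<le> b" and "a \<le> b"
  shows "total_weight S \<le> b - a"
  using assms
proof (induction S arbitrary: b rule: finite_ranking_induct[where f = fst])
  case empty
  then show ?case by (simp add: total_weight_def)
next
  case (insert I S)
  show ?case
  \<comment> \<open>The ranking induction does not guarantee that \<open>I\<close> is new.\<close>
  proof (cases "I \<in> S")
    case True
    then show ?thesis using insert.IH[of b] insert.prems by (simp add: insert_absorb)
  next
    case False
    have I: "fst I < snd I" "a \<le> fst I" "snd I \<le> b" using insert.prems by auto
    have "snd J \<le> fst I" if J: "J \<in> S" for J
    proof (rule ccontr)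
      assume "\<not> snd J \<le> fst I"
      then have "fst I \<in> points I \<inter> points J"
        using I J insert.hyps(2) by (auto simp: points_def)
      then show False
        using insert.prems(1) J False unfolding disjoint_family_on_def
        by (metis emptyE insertCI)
    qed
    then have "total_weight S \<le> fst I - a"
      using insert.prems I by (intro insert.IH) (auto simp: disjoint_family_on_def)
    then show ?thesis
      using False insert.hyps(1) I by (simp add: total_weight_def weight_def)
  qed
qed

lemma card_disjoint_covering_point_le:
  assumes "disjoint_family_on points S"
  shows "card {I\<in>S. x \<in> points I} \<le> 1"
proof (cases "\<exists>I\<in>S. x \<in> points I")
  case True
  then obtain I where "I \<in> S" "x \<in> points I" by blast
  then have "{I\<in>S. x \<in> points I} \<subseteq> {I}"
    using assms unfolding disjoint_family_on_def by blast
  then show ?thesis using card_mono[of "{I}"] by fastforce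
next
  case False
  then have "{I\<in>S. x \<in> points I} = {}" by blast
  then show ?thesis by (simp only: card.empty zero_le)
qed

text \<open>If \<open>I\<close> meets \<open>J\<close> and sticks out on the left, it contains
  \<open>fst J\<close>. If it sticks out on the right, it contains \<open>snd J\<close>, although
  \<open>J\<close> itself, being half-open, does not.\<close>

lemma conflict_covers_endpoint:
  assumes "conflict I J" "\<not> points I \<subseteq> points J"
  shows "fst J \<in> points I \<or> snd J \<in> points I"
  using assms by (force simp: conflict_def points_def)

text \<open>Members of \<open>H\<close> may overlap one another, as discarded intervals do with
  their successors, so each \<open>J\<close> is charged separately: \<open>weight J\<close> for the
  intervals of \<open>S\<close> inside members of \<open>H\<close>, and
  \<open>2 * lam * weight J\<close> for the others.\<close>

lemma total_weight_le_of_cover: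
  assumes "finite S" "finite H" "disjoint_family_on points S" "0 \<le> lam"
    and pos: "\<And>I. I \<in> S \<union> H \<Longrightarrow> fst I < snd I"
    and cover: "\<And>I. I \<in> S \<Longrightarrow> (\<exists>J\<in>H. points I \<subseteq> points J) \<or>
                  weight I \<le> lam * total_weight {J\<in>H. conflict I J}"
  shows "total_weight S \<le> (2 * lam + 1) * total_weight H"
proof -
  define C where "C = {I\<in>S. \<exists>J\<in>H. points I \<subseteq> points J}"
  have CS: "C \<subseteq> S" and fin: "finite C" "finite (S - C)"
    using assms(1) by (auto simp: C_def)
  have w: "0 \<le> weight I" if "I \<in> S \<union> H" for I
    using pos[OF that] by (simp add: weight_def)
  have disj: "disjoint_family_on points T" if "T \<subseteq> S" for T
    using assms(3) that by (rule disjoint_family_on_mono[rotated])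
  have "total_weight C \<le> (\<Sum>J\<in>H. sum weight {I\<in>C. points I \<subseteq> points J})"
    unfolding total_weight_def using fin assms(2) w CS
    by (intro sum_le_sum_fibres) (auto simp: C_def)
  also have "\<dots> \<le> (\<Sum>J\<in>H. weight J)"
  proof (rule sum_mono)
    fix J assume J: "J \<in> H"
    have "total_weight {I\<in>C. points I \<subseteq> points J} \<le> snd J - fst J"
    proof (rule total_weight_disjoint_le)
      show "fst I < snd I \<and> fst J \<le> fst I \<and> snd I \<le> snd J"
        if "I \<in> {I \<in> C. points I \<subseteq> points J}" for I
        using that pos[of I] CS points_subset_iff[of I J] by auto
    qed (use fin CS pos[of J] J in \<open>auto intro!: disj\<close>)
    then show "sum weight {I\<in>C. points I \<subseteq> points J} \<le> weight J"
      by (simp add: total_weight_def weight_def)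
  qed
  finally have contained: "total_weight C \<le> total_weight H"
    by (simp add: total_weight_def)
  have "total_weight (S - C) \<le> (\<Sum>I\<in>S - C. lam * total_weight {J\<in>H. conflict I J})"
    unfolding total_weight_def[of "S - C"] using cover by (intro sum_mono) (auto simp: C_def)
  also have "\<dots> = lam * (\<Sum>I\<in>S - C. \<Sum>J\<in>H. if conflict I J then weight J else 0)"
    using assms(2) by (simp add: total_weight_def sum.inter_filter sum_distrib_left)
  \<comment> \<open>Double counting: instead of the conflicts of each \<open>I\<close>, count how
    often each \<open>J\<close> is charged.\<close>
  also have "\<dots> = lam * (\<Sum>J\<in>H. \<Sum>I\<in>S - C. if conflict I J then weight J else 0)"
    by (subst sum.swap) simp
  also have "\<dots> = lam * (\<Sum>J\<in>H. card {I\<in>S - C. conflict I J} * weight J)"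
    using fin by (simp add: sum.inter_filter[symmetric])
  also have "\<dots> \<le> lam * (\<Sum>J\<in>H. 2 * weight J)"
  proof (intro mult_left_mono[OF _ \<open>0 \<le> lam\<close>] sum_mono mult_right_mono)
    fix J assume J: "J \<in> H"
    let ?E = "\<lambda>x. {I\<in>S. x \<in> points I}"
    have "{I\<in>S - C. conflict I J} \<subseteq> ?E (fst J) \<union> ?E (snd J)"
      using J conflict_covers_endpoint unfolding C_def by blast
    then have "card {I\<in>S - C. conflict I J} \<le> card (?E (fst J) \<union> ?E (snd J))"
      using assms(1) by (intro card_mono) auto
    also have "\<dots> \<le> card (?E (fst J)) + card (?E (snd J))"
      by (rule card_Un_le)
    also have "\<dots> \<le> 2"
      using card_disjoint_covering_point_le[OF assms(3), of "fst J"]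
        card_disjoint_covering_point_le[OF assms(3), of "snd J"] by linarith
    finally show "real (card {I\<in>S - C. conflict I J}) \<le> 2" by simp
  qed (use w in auto)
  finally have "total_weight (S - C) \<le> 2 * lam * total_weight H"
    by (simp add: total_weight_def sum_distrib_left[symmetric])
  moreover have "total_weight S = total_weight (S - C) + total_weight C"
    unfolding total_weight_def using CS assms(1) by (rule sum.subset_diff)
  ultimately show ?thesis using contained by (simp add: algebra_simps)
qed

text \<open>With coefficients a (unpredicted) and b (predicted), a \<le> b, the predictions rule
  demands 1 + a \<le> b. The worst case of the main rule, an unpredicted interval replacing
  predicted ones, demands 1 + b / \<open>lam\<close> \<le> a. The values here solve both with
  equality.\<close>

definition credit :: "real \<Rightarrow> (ivl \<Rightarrow> bool) \<Rightarrow> ivl set \<Rightarrow> real" where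
  "credit lam Prd S =
     (\<Sum>J\<in>S. (if Prd J then 2 * lam / (lam - 1) else (lam + 1) / (lam - 1)) * weight J)"

lemma credit_le:
  assumes "lam > 1" "\<And>I. I \<in> S \<Longrightarrow> 0 \<le> weight I"
  shows "credit lam Prd S \<le> 2 * lam / (lam - 1) * total_weight S"
  unfolding credit_def total_weight_def sum_distrib_left using assms
  by (intro sum_mono mult_right_mono) (auto simp: divide_right_mono)

lemma credit_unpredicted:
  "\<not> (\<exists>J\<in>S. Prd J) \<Longrightarrow> credit lam Prd S = (lam + 1) / (lam - 1) * total_weight S"
  unfolding credit_def total_weight_def sum_distrib_left by (intro sum.cong) auto

lemma credit_singleton_ge:
  assumes "lam > 1" "0 \<le> weight I"
  shows "(lam + 1) / (lam - 1) * weight I \<le> credit lam Prd {I}"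
  using assms unfolding credit_def by (auto intro!: mult_right_mono divide_right_mono)

text \<open>Here \<open>S\<close> plays the role of the discarded intervals; the two disjuncts are
  the two acceptance rules.\<close>

lemma credit_gain:
  assumes "lam > 1" "0 \<le> weight I" "\<And>J. J \<in> S \<Longrightarrow> 0 \<le> weight J"
    and "lam * total_weight S \<le> weight I \<or>
         Prd I \<and> total_weight S \<le> weight I \<and> \<not> (\<exists>J\<in>S. Prd J)"
  shows "weight I + credit lam Prd S \<le> credit lam Prd {I}"
  using assms(4)
proof (elim disjE conjE)
  assume main: "lam * total_weight S \<le> weight I"
  have "credit lam Prd S \<le> 2 / (lam - 1) * (lam * total_weight S)"
    using credit_le[of lam S Prd] assms by simp
  also have "\<dots> \<le> 2 / (lam - 1) * weight I"
    using main assms(1) by (intro mult_left_mono) auto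
  finally have "weight I + credit lam Prd S \<le> (1 + 2 / (lam - 1)) * weight I"
    by (simp add: algebra_simps)
  also have "1 + 2 / (lam - 1) = (lam + 1) / (lam - 1)"
    using assms(1) by (simp add: field_simps)
  finally show ?thesis using credit_singleton_ge[of lam I Prd] assms(1,2) by linarith
next
  assume "Prd I" and w: "total_weight S \<le> weight I" and "\<not> (\<exists>J\<in>S. Prd J)"
  then have "weight I + credit lam Prd S = weight I + (lam + 1) / (lam - 1) * total_weight S"
    using credit_unpredicted[of S Prd lam] by metis
  also have "\<dots> \<le> weight I + (lam + 1) / (lam - 1) * weight I"
    using w assms(1) by (intro add_left_mono mult_left_mono) auto
  also have "\<dots> = (1 + (lam + 1) / (lam - 1)) * weight I"
    by (simp add: algebra_simps)
  also have "1 + (lam + 1) / (lam - 1) = 2 * lam / (lam - 1)"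
    using assms(1) by (simp add: field_simps)
  finally show ?thesis using \<open>Prd I\<close> by (simp add: credit_def)
qed

text \<open>The state of the algorithm forgets discarded intervals, so the history \<open>H\<close>
  is carried as an existential witness; the induction on arrivals enlarges it exactly at
  acceptances.\<close>

lemma revoke_proportional_history:
  assumes "lam > 1" "\<And>I. I \<in> set xs \<Longrightarrow> fst I < snd I"
  shows "let A = revoke_proportional lam Prd xs in \<exists>H. A \<subseteq> H \<and> H \<subseteq> set xs \<and> total_weight H \<le> credit lam Prd A \<and>
           (\<forall>I\<in>set xs. (\<exists>J\<in>H. points I \<subseteq> points J) \<or>
              weight I \<le> lam * total_weight {J\<in>H. conflict I J})"
  using assms(2) unfolding Let_def
proof (induction xs rule: rev_induct)
  case Nil
  show ?case by (simp add: revoke_proportional_def total_weight_def credit_def)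
next
  case (snoc I xs)
  define S where "S = revoke_proportional lam Prd xs"
  define D where "D = {J\<in>S. conflict I J}"
  define covered where "covered H K \<longleftrightarrow> (\<exists>J\<in>H. points K \<subseteq> points J) \<or>
    weight K \<le> lam * total_weight {J\<in>H. conflict K J}" for H K
  obtain H where H: "S \<subseteq> H" "H \<subseteq> set xs" "total_weight H \<le> credit lam Prd S"
      "\<forall>K\<in>set xs. covered H K"
    using snoc unfolding S_def covered_def by fastforce
  have finH: "finite H" using H(2) by (rule finite_subset) simp
  have finS: "finite S" using H(1) finH by (rule finite_subset)
  have w: "0 \<le> weight K" if "K \<in> set (xs @ [I])" for K
    using snoc.prems[OF that] by (simp add: weight_def)
  have wH: "0 \<le> weight K" if "K \<in> insert I H" for K
    by (rule w) (use that H(2) in auto)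
  \<comment> \<open>A larger history keeps all containers and only adds conflicting weight.\<close>
  have covered_mono: "covered (insert I H) K" if "covered H K" for K
  proof -
    have "total_weight {J\<in>H. conflict K J} \<le> total_weight {J\<in>insert I H. conflict K J}"
      using finH wH by (intro total_weight_mono) auto
    then have "lam * total_weight {J\<in>H. conflict K J} \<le>
        lam * total_weight {J\<in>insert I H. conflict K J}"
      using assms(1) by simp
    with that show ?thesis unfolding covered_def by force
  qed
  let ?S' = "revoke_proportional_step lam Prd I S"
  have step: "revoke_proportional lam Prd (xs @ [I]) = ?S'"
    by (simp add: revoke_proportional_def S_def)
  have "\<exists>H. ?S' \<subseteq> H \<and> H \<subseteq> set (xs @ [I]) \<and> total_weight H \<le> credit lam Prd ?S' \<and>
         (\<forall>K\<in>set (xs @ [I]). covered H K)"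
  proof (cases "lam * total_weight D \<le> weight I \<or>
         Prd I \<and> total_weight D \<le> weight I \<and> \<not> (\<exists>J\<in>D. Prd J)")
    case True
    then have S': "?S' = insert I (S - D)"
      unfolding revoke_proportional_step_def Let_def D_def by auto
    \<comment> \<open>An \<open>I\<close> already in \<open>S\<close> would lie in \<open>D\<close>.
      So \<open>I\<close> enters \<open>S - D\<close> as a new element and brings its full credit,
      even if the list has repetitions.\<close>
    have "conflict I I"
      using snoc.prems[of I] by (simp add: conflict_def points_def)
    then have notin: "I \<notin> S - D" by (simp add: D_def)
    have "total_weight (insert I H) \<le> weight I + credit lam Prd S"
      using total_weight_insert_le[OF finH, of I] wH[of I] H(3) by simp
    also have "credit lam Prd S = credit lam Prd D + credit lam Prd (S - D)"
      unfolding credit_def using finS D_def by (subst sum.subset_diff[of D S]) auto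
    also have "weight I + (credit lam Prd D + credit lam Prd (S - D)) \<le>
        credit lam Prd {I} + credit lam Prd (S - D)"
      using credit_gain[OF assms(1) _ _ True] wH H(1) by (auto simp: D_def)
    also have "\<dots> = credit lam Prd ?S'"
      unfolding S' credit_def using notin finS by simp
    finally show ?thesis
      using H covered_mono
      by (intro exI[of _ "insert I H"]) (auto simp: S' covered_def)
  next
    case False
    then have S': "?S' = S"
      unfolding revoke_proportional_step_def Let_def D_def by auto
    \<comment> \<open>Rejection gives \<open>weight I < lam * total_weight D\<close>, and
      \<open>D\<close> is part of the history in conflict with \<open>I\<close>.\<close>
    have "total_weight D \<le> total_weight {J\<in>H. conflict I J}"
      using finH H(1) wH by (intro total_weight_mono) (auto simp: D_def)
    then have "lam * total_weight D \<le> lam * total_weight {J\<in>H. conflict I J}"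
      using assms(1) by simp
    then have "covered H I" using False unfolding covered_def by linarith
    then show ?thesis using H by (intro exI[of _ H]) (auto simp: S')
  qed
  then show ?case unfolding step covered_def .
qed

text \<open>Stated for every feasible \<open>S\<close> rather than for \<open>OPT\<close>, so that
  it also serves to show that the profit of the algorithm is positive.\<close>

lemma revoke_proportional_total_weight:
  assumes "lam > 1" "is_instance X" "arrival_order X xs" "feasible X S"
  shows "total_weight S \<le>
    (4 * lam\<^sup>2 + 2 * lam) / (lam - 1) * total_weight (revoke_proportional lam Prd xs)"
proof -
  let ?A = "revoke_proportional lam Prd xs"
  have X: "set xs = X" "finite X" "\<And>I. I \<in> X \<Longrightarrow> fst I < snd I"
    using assms by (auto simp: is_instance_def arrival_order_def)
  obtain H where H: "?A \<subseteq> H" "H \<subseteq> X" "total_weight H \<le> credit lam Prd ?A"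
      "\<forall>I\<in>X. (\<exists>J\<in>H. points I \<subseteq> points J) \<or>
         weight I \<le> lam * total_weight {J\<in>H. conflict I J}"
    using revoke_proportional_history[of lam xs Prd] assms(1) X unfolding Let_def by auto
  have S: "S \<subseteq> X" "disjoint_family_on points S"
    using assms(4) by (auto simp: feasible_def)
  have "total_weight S \<le> (2 * lam + 1) * total_weight H"
    using assms(1) X S H by (intro total_weight_le_of_cover) (auto intro: finite_subset)
  also have "total_weight H \<le> 2 * lam / (lam - 1) * total_weight ?A"
    using H credit_le[of lam ?A Prd] assms(1) X(3) by (force simp: weight_def)
  then have "(2 * lam + 1) * total_weight H \<le>
      (2 * lam + 1) * (2 * lam / (lam - 1) * total_weight ?A)"
    using assms(1) by (intro mult_left_mono) auto
  also have "\<dots> = (4 * lam\<^sup>2 + 2 * lam) / (lam - 1) * total_weight ?A"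
    by (simp add: power2_eq_square algebra_simps)
  finally show ?thesis .
qed

theorem theorem4p11:
  fixes lam :: real
  assumes "lam > 1"
  shows "robust ((4 * lam\<^sup>2 + 2 * lam) / (lam - 1)) (revoke_proportional lam)"
  unfolding robust_def competitive_def Let_def
proof (intro allI impI, elim conjE)
  fix Prd X xs
  assume X: "is_instance X" "arrival_order X xs"
  let ?c = "(4 * lam\<^sup>2 + 2 * lam) / (lam - 1)"
  let ?A = "total_weight (revoke_proportional lam Prd xs)"
  note bound = revoke_proportional_total_weight[OF assms X, where Prd = Prd]
  obtain I where I: "I \<in> X" "fst I < snd I"
    using X by (auto simp: is_instance_def)
  \<comment> \<open>A single interval is a feasible solution of positive weight, which forces
    \<open>?A\<close> to be positive.\<close>
  have "total_weight {I} \<le> ?c * ?A"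
    using I by (intro bound) (simp add: feasible_def disjoint_family_on_def)
  then have "0 < ?c * ?A" using I by (simp add: total_weight_def weight_def)
  moreover have "0 < ?c" using assms by (simp add: add_pos_pos)
  ultimately have pos: "0 < ?A" by (rule zero_less_mult_pos)
  have "{total_weight S | S. feasible X S} \<subseteq> total_weight ` Pow X"
    by (auto simp: feasible_def)
  then have "finite {total_weight S | S. feasible X S}"
    by (rule finite_subset) (use X in \<open>simp add: is_instance_def\<close>)
  \<comment> \<open>The empty solution shows that the maximum in \<open>OPT\<close> ranges over a
    nonempty set.\<close>
  moreover have "feasible X {}" by (simp add: feasible_def disjoint_family_on_def)
  ultimately have "OPT X \<le> ?c * ?A"
    unfolding OPT_def by (intro Max.boundedI) (use bound in blast)+
  then show "0 < ?A \<and> OPT X / ?A \<le> ?c" using pos by (simp add: pos_divide_le_eq)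
qed

end
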